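(* $$\lim_{B\to\infty}\frac{\#\mathcal{G}_2(B)}{\#\mathcal{P}(B)}=\frac{1}{3}.$$
   Context: For $B>0$ define the finite sets $$\mathcal{P}(B)=\{(r,s)\in\mathbb{Z}^2:\ \gcd(r,s)=1,\ 0<s<r,\ r\leq B\},$$ $$\mathcal{G}_2(B)=\{(k,m)\in\mathbb{Z}^2:\ \gcd(k,m)=1,\ 0<m<k\leq B,\ m\equiv 0 \pmod 2,\ k\equiv 1 \pmod 2\}.$$ Here $\#$ denotes cardinality. *)

theory Defs
  imports "HOL-Analysis.Analysis" "HOL-Number_Theory.Cong"
begin

definition P_set :: "real \<Rightarrow> (int \<times> int) set" where
  "P_set B = {(r, s). gcd r s = 1 \<and> 0 < s \<and> s < r \<and> real_of_int r \<le> B}"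

definition G2_set :: "real \<Rightarrow> (int \<times> int) set" where
  "G2_set B = {(k, m). gcd k m = 1 \<and> 0 < m \<and> m < k \<and> real_of_int k \<le> B \<and>
                       [m = 0] (mod 2) \<and> [k = 1] (mod 2)}"

text \<open>Both sets are finite, so \<^const>\<open>card\<close> is the true cardinality.\<close>

lemma finite_P_set: "finite (P_set B)"
proof (rule finite_subset)
  show "P_set B \<subseteq> {0..\<lfloor>B\<rfloor>} \<times> {0..\<lfloor>B\<rfloor>}"
    by (auto simp: P_set_def le_floor_iff)
qed simp

lemma finite_G2_set: "finite (G2_set B)"
  by (rule finite_subset[OF _ finite_P_set[of B]]) (auto simp: G2_set_def P_set_def)

end

theory Submission
  imports Defs
begin

text \<open>
  Modulo 2 a coprime pair is (odd, even), (even, odd) or (odd, odd), and the claim is that the three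
  classes are asymptotically equally frequent among the pairs with \<open>0 < s < r \<le> n\<close>.
  The reflection \<open>s \<mapsto> r - s\<close> exchanges (odd, even) and (odd, odd), so these two classes have
  exactly the same size. If \<open>F n\<close> denotes the number of (odd, even) pairs minus the number of
  (even, odd) pairs, it follows that \<open>#P = 3 #G\<^sub>2 - F\<close>
  (\<open>card_P_set_eq_three_G2_minus_excess\<close>). It remains to see that \<open>F\<close> is of smaller order than
  \<open>#P\<close>.

  Without the coprimality condition the two mixed classes differ by at most \<open>n\<close>. Sorting
  all mixed pairs by their gcd \<open>d\<close>, which is odd, gives \<open>\<Sum>\<^sub>d F (n div d) = O(n)\<close> over odd \<open>d\<close>. In the
  resulting recursion for \<open>F n\<close> the terms with \<open>d \<ge> 3\<close> are controlled by induction, because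
  \<open>\<Sum> d\<^sup>-\<^sup>3\<^sup>/\<^sup>2\<close> over odd \<open>d \<ge> 3\<close> is less than 1; this yields \<open>F n = O(n\<^sup>3\<^sup>/\<^sup>2)\<close>
  (\<open>parity_excess_bound\<close>). Sorting all pairs by gcd in the same way shows that \<open>#P\<close> has order
  \<open>n\<^sup>2\<close> (\<open>card_P_set_lower_bound\<close>), so the ratio differs from 1/3 by \<open>O(n\<^sup>-\<^sup>1\<^sup>/\<^sup>2)\<close>.
\<close>

section \<open>Triangle sums grouped by gcd\<close>

definition triangle :: "nat \<Rightarrow> (int \<times> int) set" where
  "triangle n = {(r, s). 0 < s \<and> s < r \<and> r \<le> int n}"

lemma finite_triangle: "finite (triangle n)"
  by (rule finite_subset[of _ "{0..int n} \<times> {0..int n}"]) (auto simp: triangle_def)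

lemma P_set_eq_coprime_triangle: "P_set (real n) = {p \<in> triangle n. gcd (fst p) (snd p) = 1}"
  by (auto simp: P_set_def triangle_def)

text \<open>
  The pairs with gcd \<open>d\<close> are exactly the multiples by \<open>d\<close> of the coprime pairs in the triangle of
  size \<open>n div d\<close>. With an arbitrary weight the identity serves both for counting
  pairs and for the signed count of parity classes.
\<close>

lemma triangle_sum_by_gcd:
  fixes w :: "int \<Rightarrow> int \<Rightarrow> real"
  shows "(\<Sum>(r, s)\<in>triangle n. w r s) =
         (\<Sum>d = 1..n. \<Sum>(r, s)\<in>P_set (real (n div d)). w (int d * r) (int d * s))"
proof -
  have gcd_range: "(\<lambda>(r, s). nat (gcd r s)) ` triangle n \<subseteq> {1..n}"
  proof (clarsimp simp: triangle_def)
    fix r s :: int assume rs: "0 < s" "s < r" "r \<le> int n"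
    have "gcd r s > 0" using rs by simp
    moreover have "gcd r s \<le> s" using rs by (intro zdvd_imp_le) auto
    ultimately show "Suc 0 \<le> nat (gcd r s) \<and> nat (gcd r s) \<le> n" using rs by linarith
  qed
  have "(\<Sum>(r, s)\<in>triangle n. w r s) =
        (\<Sum>d = 1..n. \<Sum>(r, s)\<in>{p \<in> triangle n. (\<lambda>(r, s). nat (gcd r s)) p = d}. w r s)"
    by (rule sum.group[OF finite_triangle _ gcd_range, symmetric]) simp
  also have "\<dots> = (\<Sum>d = 1..n. \<Sum>(r, s)\<in>P_set (real (n div d)). w (int d * r) (int d * s))"
  proof (rule sum.cong[OF refl])
    fix d assume "d \<in> {1..n}"
    then have d: "d > 0" by auto
    show "(\<Sum>(r, s)\<in>{p \<in> triangle n. (\<lambda>(r, s). nat (gcd r s)) p = d}. w r s) =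
          (\<Sum>(r, s)\<in>P_set (real (n div d)). w (int d * r) (int d * s))"
    proof (rule sum.reindex_bij_witness[where
          i = "\<lambda>(r, s). (int d * r, int d * s)" and j = "\<lambda>(r, s). (r div int d, s div int d)"],
          goal_cases)
      case (1 p)
      then show ?case by (auto simp: split: prod.splits)
    next
      case (2 p)
      obtain r s where p: "p = (r, s)" by force
      from 2 p have rs: "0 < s" "s < r" "r \<le> int n" "gcd r s = int d"
        by (auto simp: triangle_def)
      obtain a b where ab: "r = int d * a" "s = int d * b"
        using rs(4) by (metis dvd_def gcd_dvd1 gcd_dvd2)
      have "int d * gcd a b = int d" using rs(4) ab by (simp add: gcd_mult_left)
      then have "gcd a b = 1" using d by simp
      moreover have "0 < b" "b < a" using rs ab d by (auto simp: zero_less_mult_iff)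
      moreover have "a \<le> int (n div d)"
      proof -
        have "a = (int d * a) div int d" using d by simp
        also have "\<dots> \<le> int n div int d" using rs(3) ab d by (intro zdiv_mono1) auto
        finally show ?thesis by (simp add: zdiv_int)
      qed
      ultimately show ?case using p ab d by (auto simp: P_set_def)
    next
      case (3 p)
      then show ?case using d by (auto split: prod.splits)
    next
      case (4 p)
      obtain r s where p: "p = (r, s)" by force
      from 4 p have rs: "0 < s" "s < r" "r \<le> int (n div d)" "gcd r s = 1"
        by (auto simp: P_set_def)
      have "int d * r \<le> int d * int (n div d)" using rs(3) d by (intro mult_left_mono) auto
      also have "\<dots> \<le> int n" by (metis mult.commute div_times_less_eq_dividend of_nat_le_iff of_nat_mult)
      finally show ?case using rs d p by (auto simp: triangle_def gcd_mult_left)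
    next
      case (5 p)
      then show ?case by (auto split: prod.splits)
    qed
  qed
  finally show ?thesis .
qed

lemma triangle_sum_by_rows:
  fixes w :: "int \<Rightarrow> int \<Rightarrow> real"
  shows "(\<Sum>(r, s)\<in>triangle n. w r s) = (\<Sum>r<n. \<Sum>s = 1..r. w (int (Suc r)) (int s))"
proof (induction n)
  case 0
  have "triangle 0 = {}" by (auto simp: triangle_def)
  then show ?case by simp
next
  case (Suc n)
  let ?row = "(\<lambda>s. (int (Suc n), int s)) ` {1..n}"
  have split: "triangle (Suc n) = triangle n \<union> ?row"
  proof (rule set_eqI, clarify)
    fix r s :: int
    show "(r, s) \<in> triangle (Suc n) \<longleftrightarrow> (r, s) \<in> triangle n \<union> ?row"
      by (auto simp: triangle_def image_iff intro!: bexI[of _ "nat s"])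
  qed
  have "triangle n \<inter> ?row = {}" by (auto simp: triangle_def)
  then have "(\<Sum>(r, s)\<in>triangle (Suc n). w r s) =
      (\<Sum>(r, s)\<in>triangle n. w r s) + (\<Sum>(r, s)\<in>?row. w r s)"
    unfolding split by (intro sum.union_disjoint) (auto simp: finite_triangle)
  also have "(\<Sum>(r, s)\<in>?row. w r s) = (\<Sum>s = 1..n. w (int (Suc n)) (int s))"
    by (subst sum.reindex) (auto simp: inj_on_def)
  finally show ?case using Suc.IH by simp
qed

section \<open>Coprime pairs have positive density\<close>

lemma card_triangle: "real (card (triangle n)) = real n * (real n - 1) / 2"
proof -
  have "real (card (triangle n)) = (\<Sum>(r, s)\<in>triangle n. 1)" by simp
  also have "\<dots> = (\<Sum>r<n. real r)" using triangle_sum_by_rows[of "\<lambda>r s. 1" n] by simp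
  also have "\<dots> = real n * (real n - 1) / 2"
    by (induction n) (auto simp: field_simps)
  finally show ?thesis .
qed

text \<open>
  Any bound below 1 would give positive density. Keeping the first term and telescoping the rest via
  \<open>1 / d\<^sup>2 \<le> 1 / (d - 1) - 1 / d\<close> gives \<open>1 / 4 + 1 / 2\<close>.
\<close>

lemma inverse_squares_bound: "(\<Sum>d = 2..Suc n. 1 / real d ^ 2) \<le> 3 / 4"
proof -
  have "(\<Sum>d = 2..Suc n. 1 / real d ^ 2) \<le> 3 / 4 - 1 / real (Suc n)" if "n \<ge> 1"
    using that
  proof (induction n rule: dec_induct)
    case base
    show ?case by (simp add: numeral_2_eq_2 power2_eq_square)
  next
    case (step n)
    have "1 / real (Suc (Suc n)) ^ 2 \<le> 1 / (real (Suc n) * real (Suc (Suc n)))"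
      by (intro divide_left_mono) (auto simp: power2_eq_square intro!: mult_right_mono)
    also have "\<dots> = 1 / real (Suc n) - 1 / real (Suc (Suc n))"
      by (simp add: field_simps)
    finally show ?case using step by simp
  qed
  then show ?thesis
  proof (cases "n \<ge> 1")
    case True
    then have "(\<Sum>d = 2..Suc n. 1 / real d ^ 2) \<le> 3 / 4 - 1 / real (Suc n)" by fact
    also have "\<dots> \<le> 3 / 4" by simp
    finally show ?thesis .
  qed auto
qed

text \<open>
  A union bound: the pairs with gcd \<open>d \<ge> 2\<close> number at most \<open>n\<^sup>2 / (2 d\<^sup>2)\<close>, hence in total at
  most three quarters of \<open>n\<^sup>2 / 2\<close>, out of the \<open>n (n - 1) / 2\<close> pairs in the triangle.
\<close>

lemma card_P_set_lower_bound: "real (card (P_set (real n))) \<ge> real n ^ 2 / 8 - real n / 2"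
proof (cases "n = 0")
  case False
  let ?P = "\<lambda>m. real (card (P_set (real m)))"
  have upper: "?P m \<le> real m ^ 2 / 2" for m
  proof -
    have "?P m \<le> real (card (triangle m))"
      by (simp add: P_set_eq_coprime_triangle finite_triangle card_mono)
    also have "\<dots> \<le> real m ^ 2 / 2" by (simp add: card_triangle power2_eq_square algebra_simps)
    finally show ?thesis .
  qed
  have "real (card (triangle n)) = (\<Sum>d = 1..n. ?P (n div d))"
    using triangle_sum_by_gcd[of "\<lambda>r s. 1" n] by simp
  also have "\<dots> = ?P n + (\<Sum>d = 2..n. ?P (n div d))"
    using False by (subst sum.atLeast_Suc_atMost) (auto simp: numeral_2_eq_2)
  also have "(\<Sum>d = 2..n. ?P (n div d)) \<le> (\<Sum>d = 2..n. (real n ^ 2 / 2) * (1 / real d ^ 2))"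
  proof (rule sum_mono)
    fix d assume "d \<in> {2..n}"
    have "?P (n div d) \<le> real (n div d) ^ 2 / 2" by (rule upper)
    also have "\<dots> \<le> (real n / real d) ^ 2 / 2"
      by (intro divide_right_mono power_mono of_nat_div_le_of_nat) auto
    finally show "?P (n div d) \<le> (real n ^ 2 / 2) * (1 / real d ^ 2)"
      by (simp add: power_divide)
  qed
  also have "\<dots> = (real n ^ 2 / 2) * (\<Sum>d = 2..n. 1 / real d ^ 2)"
    by (simp add: sum_distrib_left)
  also have "\<dots> \<le> (real n ^ 2 / 2) * (3 / 4)"
    using inverse_squares_bound[of "n - 1"] False by (intro mult_left_mono) auto
  finally show ?thesis by (simp add: card_triangle power2_eq_square algebra_simps)
qed simp

section \<open>Balance of the mixed parity classes\<close>

definition parity_sign :: "int \<Rightarrow> int \<Rightarrow> real" where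
  "parity_sign r s =
     (if odd r \<and> even s then 1 else if even r \<and> odd s then -1 else 0)"

definition parity_excess :: "nat \<Rightarrow> real" where
  "parity_excess n = (\<Sum>(r, s)\<in>P_set (real n). parity_sign r s)"

text \<open>
  This homogeneity is why the two mixed classes are compared with each other: doubling destroys
  every mixed pair and odd multiples preserve its class, so sorting by gcd relates the
  excess only to values of the same function.
\<close>

lemma parity_sign_scale:
  "parity_sign (int d * r) (int d * s) = (if odd d then parity_sign r s else 0)"
  by (auto simp: parity_sign_def)

text \<open>
  The row \<open>r = 2 j\<close> contributes \<open>- j\<close> and the row \<open>r = 2 j + 1\<close> contributes \<open>j\<close>, so consecutive
  rows cancel and only an unpaired last row survives.
\<close>

lemma triangle_parity_sum_bound: "\<bar>\<Sum>(r, s)\<in>triangle n. parity_sign r s\<bar> \<le> real n"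
proof -
  have even_count: "(\<Sum>s = 1..r. if even s then 1 else 0) = real (r div 2)" for r :: nat
    by (induction r) (auto elim!: evenE oddE)
  have odd_count: "(\<Sum>s = 1..r. if odd s then -1 else 0) = - real (Suc r div 2)" for r :: nat
    by (induction r) (auto elim!: evenE oddE)
  have row: "(\<Sum>s = 1..r. parity_sign (int (Suc r)) (int s)) =
        (if even r then real (r div 2) else - real (Suc r div 2))" for r
  proof (cases "even r")
    case True
    then have "(\<Sum>s = 1..r. parity_sign (int (Suc r)) (int s)) =
               (\<Sum>s = 1..r. if even s then 1 else 0)"
      by (intro sum.cong) (auto simp: parity_sign_def)
    then show ?thesis using even_count True by simp
  next
    case False
    then have "(\<Sum>s = 1..r. parity_sign (int (Suc r)) (int s)) =
               (\<Sum>s = 1..r. if odd s then -1 else 0)"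
      by (intro sum.cong) (auto simp: parity_sign_def)
    then show ?thesis using odd_count False by simp
  qed
  have "(\<Sum>(r, s)\<in>triangle n. parity_sign r s) = (if odd n then 0 else - real (n div 2))"
    unfolding triangle_sum_by_rows row
    by (induction n) (auto elim!: evenE oddE)
  then show ?thesis by auto
qed

text \<open>
  Solving the sum over gcds for its term \<open>d = 1\<close>. The odd \<open>d \<ge> 3\<close> are parametrised as \<open>2 j + 1\<close>;
  letting \<open>j\<close> run up to \<open>n\<close> only adds terms with \<open>n div d = 0\<close>, which vanish.
\<close>

lemma parity_excess_recursion:
  "\<bar>parity_excess n\<bar> \<le> real n + (\<Sum>j = 1..n. \<bar>parity_excess (n div (2 * j + 1))\<bar>)"
proof (cases "n = 0")
  case True
  have "P_set (real 0) = {}" by (auto simp: P_set_def)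
  then show ?thesis using True by (simp add: parity_excess_def)
next
  case False
  let ?F = parity_excess
  have F0: "?F 0 = 0"
  proof -
    have "P_set (real 0) = {}" by (auto simp: P_set_def)
    then show ?thesis by (simp add: parity_excess_def)
  qed
  have "(\<Sum>(r, s)\<in>triangle n. parity_sign r s) = (\<Sum>d = 1..n. if odd d then ?F (n div d) else 0)"
    unfolding triangle_sum_by_gcd parity_sign_scale parity_excess_def
    by (intro sum.cong) auto
  also have "\<dots> = (\<Sum>d\<in>{d \<in> {1..n}. odd d}. ?F (n div d))"
    by (rule sum.inter_filter[symmetric]) simp
  also have "\<dots> = (\<Sum>d\<in>(\<lambda>j. 2 * j + 1) ` {0..n}. ?F (n div d))"
  proof (rule sum.mono_neutral_left)
    show "\<forall>d\<in>(\<lambda>j. 2 * j + 1) ` {0..n} - {d \<in> {1..n}. odd d}. ?F (n div d) = 0"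
    proof
      fix d assume "d \<in> (\<lambda>j. 2 * j + 1) ` {0..n} - {d \<in> {1..n}. odd d}"
      then have "n < d" by auto
      then show "?F (n div d) = 0" by (simp add: F0)
    qed
  qed (auto elim!: oddE)
  also have "\<dots> = (\<Sum>j = 0..n. ?F (n div (2 * j + 1)))"
    by (subst sum.reindex) (auto simp: inj_on_def)
  also have "\<dots> = ?F n + (\<Sum>j = 1..n. ?F (n div (2 * j + 1)))"
    by (subst sum.atLeast_Suc_atMost) auto
  finally have "?F n = (\<Sum>(r, s)\<in>triangle n. parity_sign r s) - (\<Sum>j = 1..n. ?F (n div (2 * j + 1)))"
    by simp
  moreover have "\<bar>\<Sum>j = 1..n. ?F (n div (2 * j + 1))\<bar> \<le> (\<Sum>j = 1..n. \<bar>?F (n div (2 * j + 1))\<bar>)"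
    by (rule sum_abs)
  ultimately show ?thesis using triangle_parity_sum_bound[of n] by linarith
qed

text \<open>
  The right-hand side is the mean of \<open>t\<^sup>-\<^sup>3\<^sup>/\<^sup>2\<close> over \<open>[x - 1, x + 1]\<close>, which by convexity is at
  least the value at the midpoint; summed over odd \<open>x\<close> the right-hand sides telescope. Rationalising the
  difference reduces it to \<open>sqrt (x\<^sup>2 - 1) \<le> x\<close> and \<open>sqrt (x - 1) + sqrt (x + 1) \<le> 2 * sqrt x\<close>.
\<close>

lemma inverse_three_halves_step:
  fixes x :: real assumes "x > 1"
  shows "1 / (x * sqrt x) \<le> 1 / sqrt (x - 1) - 1 / sqrt (x + 1)"
proof -
  define a b c where "a = sqrt (x - 1)" and "b = sqrt (x + 1)" and "c = sqrt x"
  have pos: "a > 0" "b > 0" "c > 0" using assms by (auto simp: a_def b_def c_def)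
  have sq: "a ^ 2 = x - 1" "b ^ 2 = x + 1" "c ^ 2 = x" using assms by (auto simp: a_def b_def c_def)
  have ab: "a * b \<le> x"
  proof -
    have "a * b = sqrt (x ^ 2 - 1)"
      by (simp add: a_def b_def power2_eq_square algebra_simps flip: real_sqrt_mult)
    also have "\<dots> \<le> sqrt (x ^ 2)" by (rule real_sqrt_le_mono) simp
    also have "\<dots> = x" using assms by simp
    finally show ?thesis .
  qed
  have sum: "a + b \<le> 2 * c"
  proof (rule power2_le_imp_le)
    show "(a + b) ^ 2 \<le> (2 * c) ^ 2" using sq ab by (simp add: power2_sum power_mult_distrib)
  qed (use pos in simp)
  have "(b - a) * (a + b) = 2" using sq by (simp add: power2_eq_square algebra_simps)
  then have "b - a = 2 / (a + b)" using pos by (simp add: field_simps)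
  moreover have "1 / a - 1 / b = (b - a) / (a * b)" using pos by (simp add: field_simps)
  ultimately have "1 / a - 1 / b = 2 / ((a * b) * (a + b))" by simp
  moreover have "2 / (x * (2 * c)) \<le> 2 / ((a * b) * (a + b))"
    using pos ab sum assms by (intro divide_left_mono mult_mono mult_pos_pos) auto
  ultimately show ?thesis by (simp add: a_def b_def c_def)
qed

lemma odd_three_halves_sum_bound:
  "(\<Sum>j = 1..n. 1 / (real (2 * j + 1) * sqrt (real (2 * j + 1)))) \<le> 3 / 4"
proof -
  have "(\<Sum>j = 1..n. 1 / (real (2 * j + 1) * sqrt (real (2 * j + 1))))
          \<le> 1 / sqrt 2 - 1 / sqrt (real (2 * n + 2))"
  proof (induction n)
    case (Suc n)
    have "1 / (real (2 * Suc n + 1) * sqrt (real (2 * Suc n + 1)))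
            \<le> 1 / sqrt (real (2 * n + 2)) - 1 / sqrt (real (2 * Suc n + 2))"
      using inverse_three_halves_step[of "real (2 * Suc n + 1)"] by (simp add: algebra_simps)
    then show ?case using Suc.IH by simp
  qed simp
  also have "\<dots> \<le> 1 / sqrt 2" by simp
  also have "\<dots> \<le> 3 / 4"
  proof -
    have "4 / 3 \<le> sqrt 2" by (rule real_le_rsqrt) (simp add: power2_eq_square)
    then show ?thesis by (simp add: field_simps)
  qed
  finally show ?thesis .
qed

text \<open>
  The exponent \<open>3 / 2\<close> lies between 1, so that the error \<open>n\<close> in the recursion is absorbed, and 2,
  the order of \<open>#P\<close>; and it is large enough for the sum over odd \<open>d \<ge> 3\<close> to stay below 1. With the
  bound \<open>3 / 4\<close> for that sum the induction closes as soon as the constant \<open>K\<close> satisfies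
  \<open>1 + 3 K / 4 \<le> K\<close>, hence \<open>K = 4\<close>.
\<close>

lemma parity_excess_bound: "\<bar>parity_excess n\<bar> \<le> 4 * (real n * sqrt (real n))"
proof (induction n rule: less_induct)
  case (less n)
  show ?case
  proof (cases "n = 0")
    case True
    then show ?thesis using parity_excess_recursion[of n] by simp
  next
    case False
    let ?g = "real n * sqrt (real n)"
    have "\<bar>parity_excess n\<bar> \<le> real n + (\<Sum>j = 1..n. \<bar>parity_excess (n div (2 * j + 1))\<bar>)"
      by (rule parity_excess_recursion)
    also have "(\<Sum>j = 1..n. \<bar>parity_excess (n div (2 * j + 1))\<bar>)
        \<le> (\<Sum>j = 1..n. 4 * ?g * (1 / (real (2 * j + 1) * sqrt (real (2 * j + 1)))))"
    proof (rule sum_mono)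
      fix j assume "j \<in> {1..n}"
      define d where "d = 2 * j + 1"
      have "d > 1" using \<open>j \<in> {1..n}\<close> by (simp add: d_def)
      then have "n div d < n" using False by simp
      then have "\<bar>parity_excess (n div d)\<bar> \<le> 4 * (real (n div d) * sqrt (real (n div d)))"
        by (rule less.IH)
      also have "\<dots> \<le> 4 * ((real n / real d) * sqrt (real n / real d))"
        by (intro mult_left_mono mult_mono real_sqrt_le_mono of_nat_div_le_of_nat) auto
      also have "\<dots> = 4 * ?g * (1 / (real d * sqrt (real d)))"
        by (simp add: real_sqrt_divide)
      finally show "\<bar>parity_excess (n div (2 * j + 1))\<bar>
          \<le> 4 * ?g * (1 / (real (2 * j + 1) * sqrt (real (2 * j + 1))))"
        by (simp only: d_def)
    qed
    also have "\<dots> = 4 * ?g * (\<Sum>j = 1..n. 1 / (real (2 * j + 1) * sqrt (real (2 * j + 1))))"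
      by (simp only: sum_distrib_left)
    also have "\<dots> \<le> 4 * ?g * (3 / 4)"
      by (intro mult_left_mono odd_three_halves_sum_bound) auto
    also have "real n + 4 * ?g * (3 / 4) \<le> 4 * ?g"
      using False by simp
    finally show ?thesis by simp
  qed
qed

section \<open>The limit\<close>

text \<open>
  With \<open>?OE\<close>, \<open>?OO\<close>, \<open>?EO\<close> the parity classes of \<open>(r, s)\<close>, the reflection \<open>s \<mapsto> r - s\<close> preserves
  coprimality and gives \<open>#OO = #OE = #G\<^sub>2\<close>, while \<open>#EO = #OE - F\<close> by definition of the excess.
\<close>

lemma card_P_set_eq_three_G2_minus_excess:
  "real (card (P_set (real n))) = 3 * real (card (G2_set (real n))) - parity_excess n"
proof -
  let ?OE = "{(r, s) \<in> P_set (real n). odd r \<and> even s}"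
  let ?OO = "{(r, s) \<in> P_set (real n). odd r \<and> odd s}"
  let ?EO = "{(r, s) \<in> P_set (real n). even r \<and> odd s}"
  have fin: "finite ?OE" "finite ?OO" "finite ?EO"
    by (rule finite_subset[OF _ finite_P_set[of "real n"]]; auto)+
  have G: "G2_set (real n) = ?OE"
    by (auto simp: G2_set_def P_set_def cong_def even_iff_mod_2_eq_zero odd_iff_mod_2_eq_one)
  have reflect: "gcd r (r - s) = gcd r s" for r s :: int
    by (metis gcd_diff2 gcd.commute)
  have "bij_betw (\<lambda>(r, s). (r, r - s)) ?OE ?OO"
    by (rule bij_betw_byWitness[where f' = "\<lambda>(r, s). (r, r - s)"]) (auto simp: P_set_def reflect)
  then have OO: "card ?OO = card ?OE" by (simp add: bij_betw_same_card)
  have "P_set (real n) = ?OE \<union> ?OO \<union> ?EO"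
    by (auto simp: P_set_def)
  then have "card (P_set (real n)) = card (?OE \<union> ?OO \<union> ?EO)" by simp
  also have "\<dots> = card ?OE + card ?OO + card ?EO"
    using fin by (subst card_Un_disjoint; (subst card_Un_disjoint)?; auto)
  finally have P: "card (P_set (real n)) = 2 * card ?OE + card ?EO" using OO by simp
  have "parity_excess n = (\<Sum>p\<in>P_set (real n). (if p \<in> ?OE then 1 else 0) - (if p \<in> ?EO then 1 else 0))"
    unfolding parity_excess_def by (intro sum.cong) (auto simp: parity_sign_def split: if_splits)
  also have "\<dots> = real (card (P_set (real n) \<inter> ?OE)) - real (card (P_set (real n) \<inter> ?EO))"
    by (simp add: sum_subtractf sum.If_cases finite_P_set)
  also have "P_set (real n) \<inter> ?OE = ?OE" by auto
  also have "P_set (real n) \<inter> ?EO = ?EO" by auto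
  finally show ?thesis using P G by simp
qed

lemma ratio_error_bound:
  assumes "n \<ge> 8"
  shows "\<bar>real (card (G2_set (real n))) / real (card (P_set (real n))) - 1 / 3\<bar> \<le> 64 / sqrt (real n)"
proof -
  let ?P = "real (card (P_set (real n)))" and ?G = "real (card (G2_set (real n)))"
  have n: "real n > 0" using assms by simp
  \<comment> \<open>From \<open>n = 8\<close> on, the linear term of the lower bound costs at most half of the quadratic one.\<close>
  have "8 * real n \<le> real n * real n" using assms by (intro mult_right_mono) auto
  then have P: "?P \<ge> real n ^ 2 / 16"
    using card_P_set_lower_bound[of n] by (simp add: power2_eq_square)
  have P0: "?P > 0" by (rule less_le_trans[OF _ P]) (use n in simp)
  have "?G / ?P - 1 / 3 = parity_excess n / (3 * ?P)"
    using P0 card_P_set_eq_three_G2_minus_excess[of n] by (simp add: field_simps)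
  then have "\<bar>?G / ?P - 1 / 3\<bar> = \<bar>parity_excess n\<bar> / (3 * ?P)" by (simp add: abs_mult)
  also have "\<dots> \<le> 4 * (real n * sqrt (real n)) / (real n ^ 2 / 16)"
    using parity_excess_bound[of n] P n P0 by (intro frac_le) auto
  also have "\<dots> = 64 / sqrt (real n)"
    using n by (simp add: field_simps power2_eq_square)
  finally show ?thesis .
qed

theorem theorem4p8:
  shows "((\<lambda>B::real. real (card (G2_set B)) / real (card (P_set B))) \<longlongrightarrow> 1 / 3) at_top"
proof -
  let ?q = "\<lambda>B::real. real (card (G2_set B)) / real (card (P_set B))"
  have "(\<lambda>n. 64 / sqrt (real n)) \<longlonglongrightarrow> 0"
    by (intro tendsto_divide_0[OF tendsto_const] filterlim_at_top_imp_at_infinity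
        filterlim_compose[OF sqrt_at_top] filterlim_real_sequentially)
  then have "(\<lambda>n. ?q (real n) - 1 / 3) \<longlonglongrightarrow> 0"
    by (rule Lim_null_comparison[rotated])
       (auto simp: eventually_sequentially intro!: exI[of _ 8] ratio_error_bound)
  then have seq: "(\<lambda>n. ?q (real n)) \<longlonglongrightarrow> 1 / 3" by (simp add: LIM_zero_iff)
  have "filterlim (\<lambda>B::real. nat \<lfloor>B\<rfloor>) sequentially at_top"
    by (intro filterlim_compose[OF filterlim_nat_sequentially] filterlim_floor_sequentially)
  then have "((\<lambda>B::real. ?q (real (nat \<lfloor>B\<rfloor>))) \<longlongrightarrow> 1 / 3) at_top"
    by (rule filterlim_compose[OF seq])
  \<comment> \<open>Both sets depend on a real \<open>B \<ge> 0\<close> only through its integer part.\<close>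
  moreover have "\<forall>\<^sub>F B in at_top. ?q (real (nat \<lfloor>B\<rfloor>)) = ?q B"
    using eventually_ge_at_top[of 0]
  proof eventually_elim
    case (elim B)
    then have "real_of_int r \<le> real (nat \<lfloor>B\<rfloor>) \<longleftrightarrow> real_of_int r \<le> B" for r
      by (simp add: le_floor_iff)
    then show ?case by (simp add: P_set_def G2_set_def)
  qed
  ultimately show ?thesis by (rule Lim_transform_eventually)
qed

end
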